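(* Let $b\in\mathbb{C}$, $b\ne0$, be such that $C_{z+b}$ is a bounded composition operator on $\mathcal{H}(\beta,\Lambda)$. Then: (1) $C_{z+b}$ is cyclic if and only if $(\lambda_n-\lambda_m)b\in\mathbb{C}\setminus 2\pi i\mathbb{Z}$ whenever $n\neq m$; (2) $C_{z+b}$ is not supercyclic.
   Context: $\Lambda=(\lambda_n)_{n\ge1}$ is a strictly increasing sequence of non-negative real numbers tending to $\infty$ with $L:=\limsup_{n\to\infty}\frac{\log n}{\lambda_n}<\infty$. $\beta=(\beta_n)_{n\ge1}$ is a sequence of positive real numbers with $\beta_*:=\liminf_{n\to\infty}\frac{\log\beta_n}{\lambda_n}\neq\pm\infty$. For $r\in\mathbb{R}$, $\mathbb{C}_r=\{z\in\mathbb{C}:\operatorname{Re}(z)>r\}$. $\mathcal{H}(\beta,\Lambda)$ is the space of Dirichlet series $f(z)=\sum_{n=1}^\infty a_ne^{-\lambda_nz}$ with $\sum_{n=1}^\infty|a_n|^2\beta_n^2<\infty$; such series converge to holomorphic functions on $\mathbb{C}_{L/2-\beta_*}$, their coefficients are uniquely determined by $f$, and $\mathcal{H}(\beta,\Lambda)$ is a Hilbert space with inner product $\langle f,g\rangle=\sum_{n}a_n\overline{b_n}\beta_n^2$. $C_\varphi f=f\circ\varphi$ ($C_{z+b}$ is $C_\varphi$ for $\varphi(z)=z+b$); "$C_\varphi$ is a bounded composition operator on $\mathcal{H}(\beta,\Lambda)$" means that $\varphi$ is a holomorphic self-map of $\mathbb{C}_{L/2-\beta_*}$ and $C_\varphi$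 maps $\mathcal{H}(\beta,\Lambda)$ into itself boundedly. For a bounded operator $T$ on a Hilbert space $\mathcal{H}$ and $x\in\mathcal{H}$, $\operatorname{Orb}(T,x)=\{T^nx:n=0,1,2,\dots\}$. $T$ is cyclic if there is $x$ with $\operatorname{Span}(\operatorname{Orb}(T,x))$ dense in $\mathcal{H}$, and supercyclic if there is $x$ with $\{\mu y:y\in\operatorname{Orb}(T,x),\ \mu\in\mathbb{C}\}$ dense in $\mathcal{H}$. *)

theory Defs
  imports "HOL-Complex_Analysis.Complex_Analysis" "HOL-Library.Function_Algebras"
begin

text \<open>
  Sequences are indexed from 1: the values of \<open>lam\<close> and \<open>beta\<close> at 0 are irrelevant, and
  coefficient sequences are normalised by \<open>a 0 = 0\<close>, so that series over all of
  \<open>nat\<close> are series over \<open>n \<ge> 1\<close>.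
\<close>

definition dirichlet_L :: "(nat \<Rightarrow> real) \<Rightarrow> ereal" where
  "dirichlet_L lam = limsup (\<lambda>n. ereal (ln (real n) / lam n))"

definition beta_star :: "(nat \<Rightarrow> real) \<Rightarrow> (nat \<Rightarrow> real) \<Rightarrow> ereal" where
  "beta_star lam beta = liminf (\<lambda>n. ereal (ln (beta n) / lam n))"

definition right_half_plane :: "real \<Rightarrow> complex set" where
  "right_half_plane r = {z. Re z > r}"

text \<open>The conversion to \<open>real\<close> is meaningful only when both quantities are finite.\<close>

definition H_domain :: "(nat \<Rightarrow> real) \<Rightarrow> (nat \<Rightarrow> real) \<Rightarrow> complex set" where
  "H_domain lam beta =
     right_half_plane (real_of_ereal (dirichlet_L lam) / 2 - real_of_ereal (beta_star lam beta))"

definition dirichlet_expansion ::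
    "(nat \<Rightarrow> real) \<Rightarrow> (nat \<Rightarrow> real) \<Rightarrow> (complex \<Rightarrow> complex) \<Rightarrow> (nat \<Rightarrow> complex) \<Rightarrow> bool" where
  "dirichlet_expansion lam beta f a \<longleftrightarrow>
     a 0 = 0 \<and>
     summable (\<lambda>n. (cmod (a n))\<^sup>2 * (beta n)\<^sup>2) \<and>
     (\<forall>z\<in>H_domain lam beta. (\<lambda>n. a n * exp (- (complex_of_real (lam n) * z))) sums f z)"

text \<open>
  Functions on the half-plane are represented by total functions vanishing outside it, so
  that equality in \<open>H_space\<close> is equality of functions on the half-plane.
\<close>

definition H_space :: "(nat \<Rightarrow> real) \<Rightarrow> (nat \<Rightarrow> real) \<Rightarrow> (complex \<Rightarrow> complex) set" where
  "H_space lam beta =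
     {f. (\<forall>z. z \<notin> H_domain lam beta \<longrightarrow> f z = 0) \<and> (\<exists>a. dirichlet_expansion lam beta f a)}"

definition H_coeff ::
    "(nat \<Rightarrow> real) \<Rightarrow> (nat \<Rightarrow> real) \<Rightarrow> (complex \<Rightarrow> complex) \<Rightarrow> nat \<Rightarrow> complex" where
  "H_coeff lam beta f = (THE a. dirichlet_expansion lam beta f a)"

definition H_inner ::
    "(nat \<Rightarrow> real) \<Rightarrow> (nat \<Rightarrow> real) \<Rightarrow> (complex \<Rightarrow> complex) \<Rightarrow> (complex \<Rightarrow> complex) \<Rightarrow> complex" where
  "H_inner lam beta f g =
     (\<Sum>n. H_coeff lam beta f n * cnj (H_coeff lam beta g n) * complex_of_real ((beta n)\<^sup>2))"

definition H_norm :: "(nat \<Rightarrow> real) \<Rightarrow> (nat \<Rightarrow> real) \<Rightarrow> (complex \<Rightarrow> complex) \<Rightarrow> real" where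
  "H_norm lam beta f = sqrt (Re (H_inner lam beta f f))"

text \<open>\<open>f \<circ> \<phi>\<close> on the half-plane, again extended by 0.\<close>

definition comp_op ::
    "(nat \<Rightarrow> real) \<Rightarrow> (nat \<Rightarrow> real) \<Rightarrow> (complex \<Rightarrow> complex) \<Rightarrow> (complex \<Rightarrow> complex) \<Rightarrow> complex \<Rightarrow> complex"
  where
  "comp_op lam beta \<phi> f = (\<lambda>z. if z \<in> H_domain lam beta then (f \<circ> \<phi>) z else 0)"

definition bounded_comp_op ::
    "(nat \<Rightarrow> real) \<Rightarrow> (nat \<Rightarrow> real) \<Rightarrow> (complex \<Rightarrow> complex) \<Rightarrow> bool" where
  "bounded_comp_op lam beta \<phi> \<longleftrightarrow>
     \<phi> holomorphic_on H_domain lam beta \<and>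
     \<phi> ` H_domain lam beta \<subseteq> H_domain lam beta \<and>
     comp_op lam beta \<phi> ` H_space lam beta \<subseteq> H_space lam beta \<and>
     (\<exists>K. \<forall>f\<in>H_space lam beta. H_norm lam beta (comp_op lam beta \<phi> f) \<le> K * H_norm lam beta f)"

definition fun_scale :: "complex \<Rightarrow> (complex \<Rightarrow> complex) \<Rightarrow> complex \<Rightarrow> complex" where
  "fun_scale c f = (\<lambda>z. c * f z)"

definition Orb :: "('a \<Rightarrow> 'a) \<Rightarrow> 'a \<Rightarrow> 'a set" where
  "Orb T x = {(T ^^ n) x | n. True}"

definition H_dense :: "(nat \<Rightarrow> real) \<Rightarrow> (nat \<Rightarrow> real) \<Rightarrow> (complex \<Rightarrow> complex) set \<Rightarrow> bool" where
  "H_dense lam beta S \<longleftrightarrow>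
     S \<subseteq> H_space lam beta \<and>
     (\<forall>f\<in>H_space lam beta. \<forall>\<epsilon>>0. \<exists>g\<in>S. H_norm lam beta (f - g) < \<epsilon>)"

definition H_cyclic ::
    "(nat \<Rightarrow> real) \<Rightarrow> (nat \<Rightarrow> real) \<Rightarrow> ((complex \<Rightarrow> complex) \<Rightarrow> complex \<Rightarrow> complex) \<Rightarrow> bool" where
  "H_cyclic lam beta T \<longleftrightarrow>
     (\<exists>x\<in>H_space lam beta. H_dense lam beta (module.span fun_scale (Orb T x)))"

definition H_supercyclic ::
    "(nat \<Rightarrow> real) \<Rightarrow> (nat \<Rightarrow> real) \<Rightarrow> ((complex \<Rightarrow> complex) \<Rightarrow> complex \<Rightarrow> complex) \<Rightarrow> bool" where
  "H_supercyclic lam beta T \<longleftrightarrow>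
     (\<exists>x\<in>H_space lam beta. H_dense lam beta {fun_scale \<mu> y | \<mu> y. y \<in> Orb T x})"

lemma module_fun_scale: "module fun_scale"
  by unfold_locales (auto simp: fun_scale_def fun_eq_iff algebra_simps)

end

theory Submission
  imports Defs
begin

text \<open>
  On coefficients, the operator induced by \<open>z \<mapsto> z + b\<close> is diagonal: it multiplies the
  \<open>n\<close>-th coefficient by \<open>w n = exp (- lam n * b)\<close>. Since the translation maps a right half-plane
  into itself, \<open>Re b \<ge> 0\<close>, so the moduli \<open>\<bar>w n\<bar>\<close> are at most 1 and do not increase with \<open>n\<close>. The condition
  on \<open>(lam n - lam m) * b\<close> says exactly that the \<open>w n\<close> are pairwise distinct. To read the problem
  on coefficients one needs that every square-summable coefficient sequence
  gives a series converging on the half-plane, and that it is determined by its sum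
  (\<open>ex_coeff\<close>, \<open>expands_unique\<close>).

  If \<open>w n = w m\<close> for some \<open>n \<noteq> m\<close>, the coefficients at \<open>n\<close> and \<open>m\<close> of every vector in the span of
  the orbit of \<open>x\<close> are proportional to those of \<open>x\<close>, and a linear functional of these two
  coefficients that vanishes on a dense set is zero.

  If the \<open>w n\<close> are distinct, every \<open>x\<close> with no vanishing coefficient is a cyclic vector. The idea is
  to filter out one monomial at a time: in the means
  \<open>(\<Sum>k<N. w m ^ (- k) * T ^ k x) / N\<close> the \<open>n\<close>-th coefficient of \<open>x\<close> is multiplied by the average of
  the first \<open>N\<close> powers of \<open>w n / w m\<close>. This average is 1 for \<open>n = m\<close>, while for \<open>n > m\<close> it stays bounded
  by 1 and tends to 0, because \<open>w n / w m\<close> lies in the closed unit disc and is not 1. The finitely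
  many coefficients with \<open>n < m\<close>, which may grow, are removed using monomials already known to
  lie in the closure, so strong induction on \<open>m\<close> puts every monomial there
  (\<open>monomial_in_closure_orbit_span\<close>). The argument treats \<open>Re b > 0\<close> and \<open>Re b = 0\<close> together.

  The operator is never supercyclic, for a reason visible on two coefficients: as
  \<open>\<bar>w 2\<bar> \<le> \<bar>w 1\<bar>\<close>, the quotient of the moduli of the second and the first coefficient of a vector
  \<open>\<mu> * T ^ k x\<close> never exceeds its value at \<open>x\<close>, which keeps these vectors away from the second
  monomial. If the first coefficient of \<open>x\<close> is zero, so is theirs, and they stay away from the
  first monomial.
\<close>

section \<open>Convergence and uniqueness of Dirichlet expansions\<close>

lemma sq_norm_add_le: "(norm (x + y))\<^sup>2 \<le> 2 * (norm x)\<^sup>2 + 2 * (norm y)\<^sup>2"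
proof -
  have "(norm (x + y))\<^sup>2 \<le> (norm x + norm y)\<^sup>2"
    by (intro power_mono norm_triangle_ineq) auto
  also have "\<dots> \<le> 2 * (norm x)\<^sup>2 + 2 * (norm y)\<^sup>2"
    using zero_le_power2[of "norm x - norm y"] by (simp add: power2_sum power2_diff)
  finally show ?thesis .
qed

locale dirichlet_space =
  fixes lam beta :: "nat \<Rightarrow> real"
  assumes lam_nonneg: "\<And>n. n \<ge> 1 \<Longrightarrow> lam n \<ge> 0"
    and lam_strict_mono: "strict_mono_on {1..} lam"
    and lam_at_top: "filterlim lam at_top sequentially"
    and L_finite: "dirichlet_L lam < \<infinity>"
    and beta_pos: "\<And>n. n \<ge> 1 \<Longrightarrow> beta n > 0"
    and beta_star_finite: "beta_star lam beta \<noteq> \<infinity>" "beta_star lam beta \<noteq> -\<infinity>"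
begin

abbreviation "\<Omega> \<equiv> H_domain lam beta"
abbreviation "H \<equiv> H_space lam beta"
abbreviation "dcoeff \<equiv> H_coeff lam beta"
abbreviation "expands \<equiv> dirichlet_expansion lam beta"

definition abscissa :: real where
  "abscissa = real_of_ereal (dirichlet_L lam) / 2 - real_of_ereal (beta_star lam beta)"

lemma mem_dom_iff: "z \<in> \<Omega> \<longleftrightarrow> Re z > abscissa"
  by (simp add: H_domain_def right_half_plane_def abscissa_def)

lemma lam_less: "1 \<le> n \<Longrightarrow> n < m \<Longrightarrow> lam n < lam m"
  using lam_strict_mono by (auto simp: strict_mono_on_def)

definition square_summable :: "(nat \<Rightarrow> complex) \<Rightarrow> bool" where
  "square_summable a \<longleftrightarrow> a 0 = 0 \<and> summable (\<lambda>n. (cmod (a n))\<^sup>2 * (beta n)\<^sup>2)"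

text \<open>
  Above the abscissa there is room to replace both limits by eventual inequalities
  \<open>ln n \<le> (L + \<delta>/2) * lam n\<close> and \<open>ln (beta n) \<ge> (beta_star - \<delta>/2) * lam n\<close>, and these bound the
  weights by \<open>n powr - p\<close> with \<open>p > 1\<close>.
\<close>

lemma summable_weight:
  assumes "\<sigma> > abscissa"
  shows "summable (\<lambda>n. exp (- (2 * lam n * \<sigma>)) / (beta n)\<^sup>2)"
proof -
  define l where "l = real_of_ereal (dirichlet_L lam)"
  define bs where "bs = real_of_ereal (beta_star lam beta)"
  define \<delta> where "\<delta> = \<sigma> - abscissa"
  have \<delta>: "\<delta> > 0" and \<sigma>: "\<sigma> + bs = l / 2 + \<delta>"
    using assms by (auto simp: \<delta>_def abscissa_def l_def bs_def)
  have ev_pos: "eventually (\<lambda>n. lam n > 0) sequentially"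
    using lam_at_top by (auto simp: filterlim_at_top_dense)
  have "eventually (\<lambda>n. 0 \<le> ereal (ln (real n) / lam n)) sequentially"
    using ev_pos eventually_ge_at_top[of 1] by eventually_elim auto
  hence "dirichlet_L lam \<ge> 0"
    unfolding dirichlet_L_def by (intro le_Limsup) auto
  hence L: "dirichlet_L lam = ereal l" and l: "l \<ge> 0"
    using L_finite by (auto simp: l_def real_of_ereal_pos ereal_real)
  have B: "beta_star lam beta = ereal bs"
    using beta_star_finite by (auto simp: bs_def ereal_real)
  have ev_L: "eventually (\<lambda>n. ereal (ln (real n) / lam n) < ereal (l + \<delta>/2)) sequentially"
    using \<delta> L unfolding dirichlet_L_def by (intro Limsup_lessD) simp
  have ev_B: "eventually (\<lambda>n. ereal (bs - \<delta>/2) < ereal (ln (beta n) / lam n)) sequentially"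
    using \<delta> B unfolding beta_star_def by (intro less_LiminfD) simp
  \<comment> \<open>The weights are at most \<open>exp (- (l + \<delta>) * lam n)\<close>, and \<open>n\<close> is at most
    \<open>exp ((l + \<delta>/2) * lam n)\<close>; \<open>p\<close> compares the two exponents.\<close>
  define p where "p = (l + \<delta>) / (l + \<delta>/2)"
  have p: "p > 1" "p * (l + \<delta>/2) = l + \<delta>"
    using l \<delta> by (auto simp: p_def field_simps)
  have "eventually (\<lambda>n. norm (exp (- (2 * lam n * \<sigma>)) / (beta n)\<^sup>2) \<le> real n powr (- p)) sequentially"
    using ev_pos ev_L ev_B eventually_ge_at_top[of 1]
  proof eventually_elim
    case (elim n)
    have bn: "beta n > 0" using beta_pos elim by simp
    have 1: "ln (real n) \<le> (l + \<delta>/2) * lam n" using elim by (simp add: field_simps)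
    have 2: "(bs - \<delta>/2) * lam n \<le> ln (beta n)" using elim by (simp add: field_simps)
    have "p * ln (real n) \<le> p * ((l + \<delta>/2) * lam n)"
      using 1 p by (intro mult_left_mono) auto
    also have "\<dots> = (l + \<delta>) * lam n"
      using p(2) by (metis mult.assoc)
    also have "\<dots> = 2 * lam n * \<sigma> + 2 * ((bs - \<delta>/2) * lam n)"
      using arg_cong[OF \<sigma>, of "\<lambda>t. 2 * lam n * t"] by (simp add: algebra_simps)
    finally have 3: "- (2 * lam n * \<sigma>) - 2 * ln (beta n) \<le> - (p * ln (real n))"
      using 2 by linarith
    have "exp (- (2 * lam n * \<sigma>)) / (beta n)\<^sup>2 = exp (- (2 * lam n * \<sigma>) - 2 * ln (beta n))"
      using bn by (simp add: exp_diff exp_double)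
    also have "\<dots> \<le> exp (- (p * ln (real n)))"
      using 3 by simp
    also have "\<dots> = real n powr (- p)"
      using elim by (simp add: powr_def)
    finally show ?case by simp
  qed
  moreover have "summable (\<lambda>n. real n powr (- p))"
    using p(1) by (simp add: summable_real_powr_iff)
  ultimately show ?thesis by (rule summable_comparison_test_ev)
qed

text \<open>
  Writing each term as \<open>u * v\<close> with \<open>u = \<bar>a n\<bar> * beta n\<close> and
  \<open>v = exp (- lam n * Re z) / beta n\<close>, the bound \<open>u * v \<le> u\<^sup>2 + v\<^sup>2\<close> splits the series into the
  squared norm of the coefficients and the sum of the weights.
\<close>

lemma abs_convergence:
  assumes "square_summable a" "z \<in> \<Omega>"
  shows "summable (\<lambda>n. cmod (a n * exp (- (complex_of_real (lam n) * z))))"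
proof (rule summable_comparison_test')
  show "summable (\<lambda>n. (cmod (a n))\<^sup>2 * (beta n)\<^sup>2 + exp (- (2 * lam n * Re z)) / (beta n)\<^sup>2)"
    using assms by (intro summable_add summable_weight) (auto simp: square_summable_def mem_dom_iff)
next
  fix n :: nat assume "n \<ge> 1"
  hence bn: "beta n > 0" by (rule beta_pos)
  define u where "u = cmod (a n) * beta n"
  define v where "v = exp (- (lam n * Re z)) / beta n"
  have "0 \<le> (u - v)\<^sup>2" "0 \<le> u * v" using bn by (auto simp: u_def v_def)
  hence "u * v \<le> u\<^sup>2 + v\<^sup>2" by (simp add: power2_diff)
  moreover have "v\<^sup>2 = exp (- (2 * lam n * Re z)) / (beta n)\<^sup>2"
    by (simp add: v_def power_divide flip: exp_double)
  moreover have "u * v = cmod (a n * exp (- (complex_of_real (lam n) * z)))"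
    using bn by (simp add: u_def v_def norm_mult)
  ultimately show "norm (cmod (a n * exp (- (complex_of_real (lam n) * z))))
      \<le> (cmod (a n))\<^sup>2 * (beta n)\<^sup>2 + exp (- (2 * lam n * Re z)) / (beta n)\<^sup>2"
    by (simp add: u_def power_mult_distrib)
qed

lemma square_summable_add:
  assumes "square_summable a" "square_summable c"
  shows "square_summable (\<lambda>n. a n + c n)"
proof -
  have bound: "norm ((cmod (a n + c n))\<^sup>2 * (beta n)\<^sup>2)
      \<le> 2 * ((cmod (a n))\<^sup>2 * (beta n)\<^sup>2) + 2 * ((cmod (c n))\<^sup>2 * (beta n)\<^sup>2)" for n
  proof -
    have "(cmod (a n + c n))\<^sup>2 * (beta n)\<^sup>2
        \<le> (2 * (cmod (a n))\<^sup>2 + 2 * (cmod (c n))\<^sup>2) * (beta n)\<^sup>2"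
      by (intro mult_right_mono sq_norm_add_le) simp
    thus ?thesis by (simp add: ring_distribs mult.assoc)
  qed
  have "summable (\<lambda>n. 2 * ((cmod (a n))\<^sup>2 * (beta n)\<^sup>2) + 2 * ((cmod (c n))\<^sup>2 * (beta n)\<^sup>2))"
    using assms unfolding square_summable_def by (intro summable_add summable_mult) auto
  hence "summable (\<lambda>n. (cmod (a n + c n))\<^sup>2 * (beta n)\<^sup>2)"
    by (rule summable_comparison_test'[where N = 0]) (rule bound)
  thus ?thesis
    using assms by (simp add: square_summable_def)
qed

lemma square_summable_scale:
  assumes "square_summable a"
  shows "square_summable (\<lambda>n. k * a n)"
proof -
  have "(cmod (k * a n))\<^sup>2 * (beta n)\<^sup>2 = (cmod k)\<^sup>2 * ((cmod (a n))\<^sup>2 * (beta n)\<^sup>2)" for n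
    by (simp add: norm_mult power_mult_distrib)
  hence "(\<lambda>n. (cmod (k * a n))\<^sup>2 * (beta n)\<^sup>2) = (\<lambda>n. (cmod k)\<^sup>2 * ((cmod (a n))\<^sup>2 * (beta n)\<^sup>2))" ..
  thus ?thesis
    using assms by (simp add: square_summable_def summable_mult)
qed

lemma expands_iff:
  "expands f a \<longleftrightarrow> square_summable a \<and>
     (\<forall>z\<in>\<Omega>. (\<lambda>n. a n * exp (- (complex_of_real (lam n) * z))) sums f z)"
  by (auto simp: dirichlet_expansion_def square_summable_def)

lemma expands_square_summable: "expands f a \<Longrightarrow> square_summable a"
  by (simp add: expands_iff)

lemma expands_add:
  assumes "expands f a" "expands g c"
  shows "expands (f + g) (\<lambda>n. a n + c n)"
  using assms by (simp add: expands_iff square_summable_add sums_add distrib_right)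

lemma expands_scale: "expands f a \<Longrightarrow> expands (fun_scale k f) (\<lambda>n. k * a n)"
  by (simp add: expands_iff square_summable_scale fun_scale_def mult.assoc sums_mult)

text \<open>
  The coefficient with least index \<open>m\<close> dominates far to the right: along \<open>z = \<sigma> + j\<close>, the series
  multiplied by \<open>exp (j * lam m)\<close> tends to a nonzero multiple of \<open>c m\<close> as \<open>j\<close> grows. Absolute convergence
  at \<open>\<sigma>\<close> supplies the domination for Tannery's theorem.
\<close>

lemma expands_zero_imp:
  assumes "expands (\<lambda>_. 0) c"
  shows "c = (\<lambda>_. 0)"
proof (rule ccontr)
  assume "c \<noteq> (\<lambda>_. 0)"
  then obtain n where "c n \<noteq> 0" by auto
  define m where "m = (LEAST n. c n \<noteq> 0)"
  have cm: "c m \<noteq> 0" unfolding m_def using \<open>c n \<noteq> 0\<close> by (rule LeastI)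
  have below: "c k = 0" if "k < m" for k
    using not_less_Least[of k "\<lambda>n. c n \<noteq> 0"] that by (auto simp: m_def)
  have ss: "square_summable c" using assms by (rule expands_square_summable)
  hence "m \<ge> 1" using cm by (cases m) (auto simp: square_summable_def)
  define \<sigma> where "\<sigma> = abscissa + 1"
  define t where "t k = c k * exp (- (of_real (lam k) * of_real \<sigma>))" for k
  have t_summable: "summable (\<lambda>k. norm (t k))"
    using abs_convergence[OF ss, of "of_real \<sigma>"] by (simp add: t_def mem_dom_iff \<sigma>_def)
  define q :: "nat \<Rightarrow> complex" where "q k = of_real (exp (- (lam k - lam m)))" for k
  have "(\<lambda>j. \<Sum>k. t k * q k ^ j) \<longlonglongrightarrow> (\<Sum>k. if k = m then t m else 0)"
  proof (rule conjunct2[OF conjunct2[OF tannerys_theorem]])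
    show "(\<lambda>j. t k * q k ^ j) \<longlonglongrightarrow> (if k = m then t m else 0)" for k
    proof (cases k m rule: linorder_cases)
      case greater
      have "norm (q k) < 1"
        using lam_less[OF \<open>m \<ge> 1\<close> greater] by (simp add: q_def)
      from tendsto_mult_right_zero[OF LIMSEQ_power_zero[OF this]] greater
      show ?thesis by simp
    qed (auto simp: q_def t_def below)
    show "\<forall>\<^sub>F (k, j) in at_top \<times>\<^sub>F sequentially. norm (t k * q k ^ j) \<le> norm (t k)"
    proof (intro always_eventually allI, clarify)
      fix k j
      show "norm (t k * q k ^ j) \<le> norm (t k)"
      proof (cases "k < m")
        case False
        hence "lam m \<le> lam k"
          using lam_less[OF \<open>m \<ge> 1\<close>, of k] by (cases "k = m") auto
        hence "norm (q k) ^ j \<le> 1"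
          by (intro power_le_one) (auto simp: q_def)
        thus ?thesis
          by (simp add: norm_mult norm_power mult_left_le)
      qed (simp add: t_def below)
    qed
  qed (use t_summable in auto)
  moreover have "(\<Sum>k. t k * q k ^ j) = 0" for j
  proof -
    have "of_real (\<sigma> + real j) \<in> \<Omega>" by (simp add: mem_dom_iff \<sigma>_def)
    hence "(\<lambda>k. c k * exp (- (of_real (lam k) * of_real (\<sigma> + real j)))) sums 0"
      using assms unfolding dirichlet_expansion_def by blast
    from sums_mult[OF this, of "exp (of_real (real j * lam m))"]
    have "(\<lambda>k. exp (of_real (real j * lam m)) * (c k * exp (- (of_real (lam k) * of_real (\<sigma> + real j))))) sums 0"
      by simp
    also have "(\<lambda>k. exp (of_real (real j * lam m)) * (c k * exp (- (of_real (lam k) * of_real (\<sigma> + real j)))))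
        = (\<lambda>k. t k * q k ^ j)"
    proof
      fix k
      have "q k ^ j = exp (of_real (real j * lam m) - of_real (real j * lam k))"
        by (simp add: q_def exp_of_nat_mult[symmetric] exp_of_real[symmetric] algebra_simps flip: of_real_power)
      thus "exp (of_real (real j * lam m)) * (c k * exp (- (of_real (lam k) * of_real (\<sigma> + real j)))) = t k * q k ^ j"
        by (simp add: t_def algebra_simps exp_diff exp_add exp_minus divide_inverse)
    qed
    finally show ?thesis by (simp add: sums_iff)
  qed
  ultimately have "(\<lambda>j::nat. 0::complex) \<longlonglongrightarrow> (\<Sum>k. if k = m then t m else 0)" by simp
  also have "(\<Sum>k. if k = m then t m else 0) = t m"
    using suminf_finite[of "{m}" "\<lambda>k. if k = m then t m else 0"] by simp
  finally have "t m = 0" by (simp add: LIMSEQ_const_iff)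
  thus False using cm by (simp add: t_def)
qed

lemma expands_unique:
  assumes "expands f a" "expands f c"
  shows "a = c"
proof -
  have "expands (f + fun_scale (-1) f) (\<lambda>n. a n + (-1) * c n)"
    using assms by (intro expands_add expands_scale)
  moreover have "f + fun_scale (-1) f = (\<lambda>_. 0)"
    by (auto simp: fun_scale_def)
  ultimately have "(\<lambda>n. a n + (-1) * c n) = (\<lambda>_. 0)"
    by (simp only: expands_zero_imp)
  thus ?thesis by (auto simp: fun_eq_iff)
qed

section \<open>The Hilbert space on coefficients\<close>

lemma coeff_eqI: "expands f a \<Longrightarrow> dcoeff f = a"
  unfolding H_coeff_def using expands_unique by blast

lemma expands_coeff: "f \<in> H \<Longrightarrow> expands f (dcoeff f)"
  using coeff_eqI by (auto simp: H_space_def)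

lemma coeff_0: "f \<in> H \<Longrightarrow> dcoeff f 0 = 0"
  using expands_coeff by (auto simp: dirichlet_expansion_def)

lemma coeff_summable: "f \<in> H \<Longrightarrow> summable (\<lambda>n. (cmod (dcoeff f n))\<^sup>2 * (beta n)\<^sup>2)"
  using expands_coeff by (auto simp: dirichlet_expansion_def)

lemma H_add: "f \<in> H \<Longrightarrow> g \<in> H \<Longrightarrow> f + g \<in> H"
  unfolding H_space_def using expands_add by fastforce

lemma H_scale: "f \<in> H \<Longrightarrow> fun_scale k f \<in> H"
  unfolding H_space_def using expands_scale by (fastforce simp: fun_scale_def)

lemma H_zero: "0 \<in> H"
  unfolding H_space_def dirichlet_expansion_def by (auto intro!: exI[of _ "\<lambda>_. 0"])

lemma minus_eq: "f - g = f + fun_scale (-1) g"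
  by (auto simp: fun_scale_def)

lemma H_diff: "f \<in> H \<Longrightarrow> g \<in> H \<Longrightarrow> f - g \<in> H"
  unfolding minus_eq by (intro H_add H_scale)

lemma subspace_H: "module.subspace fun_scale H"
  by (auto simp: module.subspace_def[OF module_fun_scale] H_zero H_add H_scale)

lemma coeff_add: "f \<in> H \<Longrightarrow> g \<in> H \<Longrightarrow> dcoeff (f + g) n = dcoeff f n + dcoeff g n"
  by (simp add: coeff_eqI[OF expands_add[OF expands_coeff expands_coeff]] del: plus_fun_apply)

lemma coeff_scale: "f \<in> H \<Longrightarrow> dcoeff (fun_scale k f) n = k * dcoeff f n"
  by (simp add: coeff_eqI[OF expands_scale[OF expands_coeff]])

lemma coeff_diff: "f \<in> H \<Longrightarrow> g \<in> H \<Longrightarrow> dcoeff (f - g) n = dcoeff f n - dcoeff g n"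
  by (simp add: minus_eq coeff_add coeff_scale H_scale del: plus_fun_apply)

lemma coeff_zero: "dcoeff 0 n = 0"
  using coeff_scale[OF H_zero, of 0 n] by (simp add: fun_scale_def zero_fun_def)

lemma coeff_sum:
  assumes "\<And>i. i \<in> I \<Longrightarrow> f i \<in> H"
  shows "dcoeff (\<Sum>i\<in>I. f i) n = (\<Sum>i\<in>I. dcoeff (f i) n)"
  using assms
proof (induction I rule: infinite_finite_induct)
  case (insert i I)
  have "(\<Sum>i\<in>I. f i) \<in> H"
    using insert by (intro module.subspace_sum[OF module_fun_scale subspace_H]) auto
  thus ?case using insert by (simp add: coeff_add del: plus_fun_apply)
qed (auto simp: coeff_zero)

definition normsq :: "(complex \<Rightarrow> complex) \<Rightarrow> real" where
  "normsq f = (\<Sum>n. (cmod (dcoeff f n))\<^sup>2 * (beta n)\<^sup>2)"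

lemma H_norm_eq:
  assumes "f \<in> H"
  shows "H_norm lam beta f = sqrt (normsq f)"
proof -
  have "dcoeff f n * cnj (dcoeff f n) * complex_of_real ((beta n)\<^sup>2)
      = complex_of_real ((cmod (dcoeff f n))\<^sup>2 * (beta n)\<^sup>2)" for n
    by (simp add: complex_norm_square[symmetric])
  thus ?thesis
    using coeff_summable[OF assms]
    by (simp add: H_norm_def H_inner_def normsq_def suminf_of_real[symmetric] del: of_real_mult of_real_power)
qed

lemma coeff_le_normsq:
  assumes "f \<in> H"
  shows "(cmod (dcoeff f n) * beta n)\<^sup>2 \<le> normsq f"
  using sum_le_suminf[OF coeff_summable[OF assms], of "{n}"]
  by (simp add: normsq_def power_mult_distrib)


lemma square_summable_dominated:
  assumes "square_summable a" "\<And>n. cmod (c n) \<le> cmod (a n)"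
  shows "square_summable c"
proof -
  have bound: "norm ((cmod (c n))\<^sup>2 * (beta n)\<^sup>2) \<le> (cmod (a n))\<^sup>2 * (beta n)\<^sup>2" for n
    using assms(2)[of n] by (simp add: mult_right_mono power_mono)
  have "summable (\<lambda>n. (cmod (a n))\<^sup>2 * (beta n)\<^sup>2)"
    using assms(1) by (simp add: square_summable_def)
  hence "summable (\<lambda>n. (cmod (c n))\<^sup>2 * (beta n)\<^sup>2)"
    by (rule summable_comparison_test'[where N = 0]) (rule bound)
  thus ?thesis
    using assms(2)[of 0] assms(1) by (simp add: square_summable_def)
qed

lemma H_I: "expands f a \<Longrightarrow> (\<And>z. z \<notin> \<Omega> \<Longrightarrow> f z = 0) \<Longrightarrow> f \<in> H"
  by (auto simp: H_space_def)

lemma ex_coeff: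
  assumes "square_summable a"
  shows "\<exists>f\<in>H. dcoeff f = a"
proof
  define f where
    "f z = (if z \<in> \<Omega> then \<Sum>n. a n * exp (- (complex_of_real (lam n) * z)) else 0)" for z
  have "expands f a"
    using assms by (simp add: expands_iff f_def abs_convergence summable_norm_cancel summable_sums)
  thus "dcoeff f = a" "f \<in> H"
    by (auto intro: coeff_eqI H_I simp: f_def)
qed

definition monomial :: "nat \<Rightarrow> complex \<Rightarrow> complex" where
  "monomial n z = (if z \<in> \<Omega> then exp (- (complex_of_real (lam n) * z)) else 0)"

lemma expands_monomial:
  assumes "n \<ge> 1"
  shows "expands (monomial n) (\<lambda>k. if k = n then 1 else 0)"
proof -
  have "(\<lambda>k. (cmod (if k = n then 1 else 0))\<^sup>2 * (beta k)\<^sup>2) = (\<lambda>k. if k = n then (beta k)\<^sup>2 else 0)"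
    by auto
  moreover have "(\<lambda>k. (if k = n then 1 else 0) * exp (- (complex_of_real (lam k) * z)))
      = (\<lambda>k. if k = n then exp (- (complex_of_real (lam k) * z)) else 0)" for z
    by auto
  ultimately show ?thesis
    using assms sums_single[of n "\<lambda>k. (beta k)\<^sup>2"]
      sums_single[of n "\<lambda>k. exp (- (complex_of_real (lam k) * z))" for z]
    by (auto simp: expands_iff square_summable_def monomial_def sums_iff)
qed

lemma monomial_in_H: "n \<ge> 1 \<Longrightarrow> monomial n \<in> H"
  using expands_monomial by (rule H_I) (auto simp: monomial_def)

lemma coeff_monomial: "n \<ge> 1 \<Longrightarrow> dcoeff (monomial n) k = (if k = n then 1 else 0)"
  by (simp add: coeff_eqI[OF expands_monomial])

text \<open>
  Closures only need a triangle inequality up to a constant, and this one holds termwise for the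
  squared norm.
\<close>

lemma normsq_add_le:
  assumes "f \<in> H" "g \<in> H"
  shows "normsq (f + g) \<le> 2 * normsq f + 2 * normsq g"
proof -
  note sf = summable_mult[OF coeff_summable[OF assms(1)], of 2]
  note sg = summable_mult[OF coeff_summable[OF assms(2)], of 2]
  have "(cmod (dcoeff (f + g) n))\<^sup>2 * (beta n)\<^sup>2
     \<le> 2 * ((cmod (dcoeff f n))\<^sup>2 * (beta n)\<^sup>2) + 2 * ((cmod (dcoeff g n))\<^sup>2 * (beta n)\<^sup>2)" for n
    using sq_norm_add_le[of "dcoeff f n" "dcoeff g n"]
      mult_right_mono[OF sq_norm_add_le, of "(beta n)\<^sup>2" "dcoeff f n" "dcoeff g n"]
    by (simp add: coeff_add[OF assms] ring_distribs mult.assoc del: plus_fun_apply)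
  hence "normsq (f + g) \<le> (\<Sum>n. 2 * ((cmod (dcoeff f n))\<^sup>2 * (beta n)\<^sup>2) + 2 * ((cmod (dcoeff g n))\<^sup>2 * (beta n)\<^sup>2))"
    unfolding normsq_def using assms by (intro suminf_le coeff_summable H_add summable_add sf sg)
  also have "\<dots> = 2 * normsq f + 2 * normsq g"
    unfolding normsq_def
    by (simp add: suminf_add[OF sf sg, symmetric] suminf_mult[OF coeff_summable] assms)
  finally show ?thesis .
qed

lemma normsq_scale: "f \<in> H \<Longrightarrow> normsq (fun_scale k f) = (cmod k)\<^sup>2 * normsq f"
  unfolding normsq_def
  by (simp add: coeff_scale norm_mult power_mult_distrib mult.assoc suminf_mult[OF coeff_summable])

text \<open>
  Dominated convergence for coefficients. It controls both the truncation of a series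
  and the means of an orbit.
\<close>

lemma normsq_tendsto_0:
  assumes "f \<in> H"
    and "\<And>j n. cmod (dcoeff (g j) n) \<le> cmod (dcoeff f n)"
    and "\<And>n. (\<lambda>j. dcoeff (g j) n) \<longlonglongrightarrow> 0"
  shows "(\<lambda>j. normsq (g j)) \<longlonglongrightarrow> 0"
proof -
  have "(\<lambda>j. \<Sum>n. (cmod (dcoeff (g j) n))\<^sup>2 * (beta n)\<^sup>2) \<longlonglongrightarrow> (\<Sum>n. (0::real))"
  proof (rule conjunct2[OF conjunct2[OF tannerys_theorem]])
    show "(\<lambda>j. (cmod (dcoeff (g j) n))\<^sup>2 * (beta n)\<^sup>2) \<longlonglongrightarrow> 0" for n
      using assms(3)[of n] by (auto intro!: tendsto_eq_intros)
    show "\<forall>\<^sub>F (n, j) in at_top \<times>\<^sub>F sequentially.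
        norm ((cmod (dcoeff (g j) n))\<^sup>2 * (beta n)\<^sup>2) \<le> (cmod (dcoeff f n))\<^sup>2 * (beta n)\<^sup>2"
      using assms(2) by (intro always_eventually) (auto intro!: mult_right_mono power_mono)
  qed (use coeff_summable[OF assms(1)] in auto)
  thus ?thesis by (simp add: normsq_def)
qed

section \<open>Closures and dense subsets\<close>

definition H_closure :: "(complex \<Rightarrow> complex) set \<Rightarrow> (complex \<Rightarrow> complex) set" where
  "H_closure S = {f \<in> H. \<forall>\<epsilon>>0. \<exists>g\<in>S. normsq (f - g) < \<epsilon>}"

lemma H_dense_iff_closure:
  assumes "S \<subseteq> H"
  shows "H_dense lam beta S \<longleftrightarrow> H \<subseteq> H_closure S"
proof
  assume D: "H_dense lam beta S"
  show "H \<subseteq> H_closure S"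
    unfolding H_closure_def
  proof (intro subsetI CollectI conjI allI impI)
    fix f and \<epsilon> :: real assume "f \<in> H" "\<epsilon> > 0"
    then obtain g where g: "g \<in> S" "H_norm lam beta (f - g) < sqrt \<epsilon>"
      using D unfolding H_dense_def by (meson real_sqrt_gt_zero)
    have "f - g \<in> H" using g assms \<open>f \<in> H\<close> by (intro H_diff) auto
    thus "\<exists>g\<in>S. normsq (f - g) < \<epsilon>"
      using g by (auto simp: H_norm_eq simp del: fun_diff_def)
  qed
next
  assume cl: "H \<subseteq> H_closure S"
  show "H_dense lam beta S"
    unfolding H_dense_def
  proof (intro conjI ballI allI impI assms)
    fix f and \<epsilon> :: real assume f: "f \<in> H" and "\<epsilon> > 0"
    hence "\<epsilon>\<^sup>2 > 0" by simp
    then obtain g where g: "g \<in> S" "normsq (f - g) < \<epsilon>\<^sup>2"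
      using cl f unfolding H_closure_def by blast
    have "f - g \<in> H" using g assms f by (intro H_diff) auto
    thus "\<exists>g\<in>S. H_norm lam beta (f - g) < \<epsilon>"
      using g \<open>\<epsilon> > 0\<close> by (auto simp: H_norm_eq real_sqrt_less_iff intro!: bexI[of _ g] real_less_lsqrt)
  qed
qed

lemma subset_closure:
  assumes "S \<subseteq> H"
  shows "S \<subseteq> H_closure S"
  unfolding H_closure_def
proof (intro subsetI CollectI conjI allI impI)
  fix f and \<epsilon> :: real assume f: "f \<in> S"
  thus "f \<in> H" using assms by blast
  assume "\<epsilon> > 0"
  moreover have "normsq (f - f) = 0" by (simp only: diff_self normsq_def coeff_zero) simp
  ultimately show "\<exists>g\<in>S. normsq (f - g) < \<epsilon>" using f by (intro bexI[of _ f]) simp_all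
qed

lemma closure_closed:
  assumes S: "S \<subseteq> H" and f: "f \<in> H"
    and approx: "\<And>\<epsilon>. \<epsilon> > 0 \<Longrightarrow> \<exists>h\<in>H_closure S. normsq (f - h) < \<epsilon>"
  shows "f \<in> H_closure S"
  unfolding H_closure_def
proof (intro CollectI conjI allI impI f)
  fix \<epsilon> :: real assume "\<epsilon> > 0"
  then obtain h where h: "h \<in> H_closure S" "normsq (f - h) < \<epsilon> / 4"
    using approx[of "\<epsilon> / 4"] by auto
  then obtain g where g: "g \<in> S" "normsq (h - g) < \<epsilon> / 4"
    using \<open>\<epsilon> > 0\<close> unfolding H_closure_def by (auto dest!: spec[of _ "\<epsilon> / 4"])
  have "h \<in> H" "g \<in> H" using h g S by (auto simp: H_closure_def)
  hence "normsq ((f - h) + (h - g)) \<le> 2 * normsq (f - h) + 2 * normsq (h - g)"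
    using f by (intro normsq_add_le H_diff)
  also have "\<dots> < \<epsilon>" using h g by linarith
  also have "(f - h) + (h - g) = f - g" by simp
  finally show "\<exists>g\<in>S. normsq (f - g) < \<epsilon>" using g by blast
qed

lemma subspace_closure:
  assumes S: "S \<subseteq> H" and sub: "module.subspace fun_scale S"
  shows "module.subspace fun_scale (H_closure S)"
  unfolding module.subspace_def[OF module_fun_scale]
proof (intro conjI ballI allI)
  show "0 \<in> H_closure S"
    using subset_closure[OF S] module.subspace_0[OF module_fun_scale sub] by blast
next
  fix f f' assume ff': "f \<in> H_closure S" "f' \<in> H_closure S"
  hence H: "f \<in> H" "f' \<in> H" by (auto simp: H_closure_def)
  show "f + f' \<in> H_closure S"
    unfolding H_closure_def
  proof (intro CollectI conjI allI impI H_add H)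
    fix \<epsilon> :: real assume "\<epsilon> > 0"
    hence "\<epsilon> / 4 > 0" by simp
    then obtain g g' where g: "g \<in> S" "normsq (f - g) < \<epsilon> / 4" "g' \<in> S" "normsq (f' - g') < \<epsilon> / 4"
      using ff' unfolding H_closure_def by blast
    hence "normsq ((f - g) + (f' - g')) \<le> 2 * normsq (f - g) + 2 * normsq (f' - g')"
      using H S by (intro normsq_add_le H_diff) auto
    also have "\<dots> < \<epsilon>" using g by linarith
    also have "(f - g) + (f' - g') = (f + f') - (g + g')" by simp
    finally show "\<exists>g\<in>S. normsq (f + f' - g) < \<epsilon>"
      using g module.subspace_add[OF module_fun_scale sub] by blast
  qed
next
  fix k f assume f: "f \<in> H_closure S"
  hence H: "f \<in> H" by (auto simp: H_closure_def)
  show "fun_scale k f \<in> H_closure S"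
    unfolding H_closure_def
  proof (intro CollectI conjI allI impI H_scale H)
    fix \<epsilon> :: real assume "\<epsilon> > 0"
    define K where "K = (cmod k)\<^sup>2 + 1"
    have "K > 0" by (simp add: K_def add_nonneg_pos)
    hence "\<epsilon> / K > 0" using \<open>\<epsilon> > 0\<close> by simp
    then obtain g where g: "g \<in> S" "normsq (f - g) < \<epsilon> / K"
      using f unfolding H_closure_def by blast
    have fg: "f - g \<in> H" using g H S by (intro H_diff) auto
    have "0 \<le> normsq (f - g)"
      using order.trans[OF zero_le_power2 coeff_le_normsq[OF fg]] .
    hence "normsq (fun_scale k (f - g)) \<le> K * normsq (f - g)"
      by (simp add: normsq_scale[OF fg] K_def mult_right_mono)
    also have "\<dots> < \<epsilon>" using g \<open>K > 0\<close> by (simp add: field_simps)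
    also have "fun_scale k (f - g) = fun_scale k f - fun_scale k g"
      by (auto simp: fun_scale_def algebra_simps)
    finally show "\<exists>g\<in>S. normsq (fun_scale k f - g) < \<epsilon>"
      using g module.subspace_scale[OF module_fun_scale sub] by blast
  qed
qed

text \<open>The partial sums of the expansion of \<open>f\<close> converge to \<open>f\<close> in norm.\<close>

lemma H_subset_closure_if_monomials:
  assumes S: "S \<subseteq> H" and sub: "module.subspace fun_scale S"
    and mono: "\<And>n. n \<ge> 1 \<Longrightarrow> monomial n \<in> H_closure S"
  shows "H \<subseteq> H_closure S"
proof
  fix f assume f: "f \<in> H"
  define p where "p N = (\<Sum>n\<in>{1..N}. fun_scale (dcoeff f n) (monomial n))" for N
  have p_cl: "p N \<in> H_closure S" for N
    unfolding p_def
    by (intro module.subspace_sum[OF module_fun_scale subspace_closure[OF S sub]]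
          module.subspace_scale[OF module_fun_scale subspace_closure[OF S sub]] mono) auto
  hence pH: "p N \<in> H" for N by (auto simp: H_closure_def)
  have coeff_p: "dcoeff (f - p N) n = (if n \<le> N then 0 else dcoeff f n)" for N n
  proof -
    have "dcoeff (p N) n = (\<Sum>i\<in>{1..N}. if n = i then dcoeff f i else 0)"
      unfolding p_def
      by (subst coeff_sum) (auto simp: H_scale monomial_in_H coeff_scale coeff_monomial mult_delta_right)
    thus ?thesis
      using coeff_0[OF f] by (cases "n = 0") (auto simp: coeff_diff[OF f pH] simp del: fun_diff_def)
  qed
  have "(\<lambda>N. normsq (f - p N)) \<longlonglongrightarrow> 0"
  proof (rule normsq_tendsto_0[OF f])
    fix n
    have "eventually (\<lambda>N. dcoeff (f - p N) n = 0) sequentially"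
      using eventually_ge_at_top[of n] by eventually_elim (simp only: coeff_p if_True)
    thus "(\<lambda>N. dcoeff (f - p N) n) \<longlonglongrightarrow> 0" by (rule tendsto_eventually)
  qed (simp add: coeff_p del: fun_diff_def)
  hence "\<exists>N. normsq (f - p N) < \<epsilon>" if "\<epsilon> > 0" for \<epsilon>
    using that eventually_happens[OF order_tendstoD(2)] by fastforce
  thus "f \<in> H_closure S"
    using closure_closed[OF S f] p_cl by blast
qed

text \<open>
  The only consequence of density needed for the negative results, weighted so that it contradicts
  a linear relation or inequality between two coefficients directly: both coefficients of the
  approximating vector are within \<open>\<epsilon> / beta\<close> of their targets 1 and 0, and \<open>\<epsilon>\<close> is chosen to make the weighted
  error less than \<open>A\<close>.
\<close>

lemma dense_near_monomial:
  assumes D: "H_dense lam beta S" and nm: "n \<ge> 1" "m \<ge> 1" "n \<noteq> m" and AC: "A > 0" "C \<ge> 0"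
  shows "\<exists>g\<in>S. A * cmod (1 - dcoeff g n) + C * cmod (dcoeff g m) < A"
proof -
  have pos: "beta n > 0" "beta m > 0" using nm beta_pos by auto
  define \<epsilon> where "\<epsilon> = A / (A / beta n + C / beta m)"
  have "A / beta n + C / beta m > 0" using pos AC by (intro add_pos_nonneg) auto
  hence \<epsilon>: "\<epsilon> > 0" "(A / beta n + C / beta m) * \<epsilon> = A" using AC by (auto simp: \<epsilon>_def)
  then obtain g where g: "g \<in> S" "H_norm lam beta (monomial n - g) < \<epsilon>"
    using D monomial_in_H[OF nm(1)] unfolding H_dense_def by blast
  have gH: "g \<in> H" using g D by (auto simp: H_dense_def)
  have dH: "monomial n - g \<in> H" by (intro H_diff monomial_in_H nm gH)
  have "cmod (dcoeff (monomial n - g) k) * beta k < \<epsilon>" for k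
  proof -
    have "\<bar>cmod (dcoeff (monomial n - g) k) * beta k\<bar> \<le> H_norm lam beta (monomial n - g)"
      unfolding H_norm_eq[OF dH] by (rule real_le_rsqrt) (simp only: power2_abs coeff_le_normsq[OF dH])
    thus ?thesis using g(2) by linarith
  qed
  from this[of n] this[of m] have
    "cmod (1 - dcoeff g n) < \<epsilon> / beta n" "cmod (dcoeff g m) < \<epsilon> / beta m"
    using pos nm gH by (auto simp: coeff_diff monomial_in_H coeff_monomial field_simps simp del: fun_diff_def)
  hence "A * cmod (1 - dcoeff g n) + C * cmod (dcoeff g m) < A * (\<epsilon> / beta n) + C * (\<epsilon> / beta m)"
    using AC by (intro add_less_le_mono mult_strict_left_mono mult_left_mono) auto
  also have "\<dots> = A" using \<epsilon>(2) by (simp add: algebra_simps)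
  finally show ?thesis using g by blast
qed

end

section \<open>Averages of powers in the unit disc\<close>

text \<open>The average runs over \<open>Suc N\<close> powers so that it equals 1 at \<open>\<rho> = 1\<close> for every \<open>N\<close>.\<close>

definition cesaro :: "complex \<Rightarrow> nat \<Rightarrow> complex" where
  "cesaro \<rho> N = (\<Sum>k<Suc N. \<rho> ^ k) / of_nat (Suc N)"

lemma norm_cesaro_le:
  assumes "norm \<rho> \<le> 1"
  shows "norm (cesaro \<rho> N) \<le> 1"
proof -
  have "norm (\<Sum>k<Suc N. \<rho> ^ k) \<le> (\<Sum>k<Suc N. 1)"
    using assms by (intro sum_norm_le) (simp add: norm_power power_le_one)
  thus ?thesis by (simp add: cesaro_def norm_divide field_simps del: of_nat_Suc)
qed

lemma cesaro_1: "cesaro 1 N = 1"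
  by (simp add: cesaro_def del: of_nat_Suc)

lemma cesaro_tendsto_0:
  assumes "norm \<rho> \<le> 1" "\<rho> \<noteq> 1"
  shows "cesaro \<rho> \<longlonglongrightarrow> 0"
proof (rule Lim_null_comparison)
  define c where "c = 2 / norm (\<rho> - 1)"
  show "\<forall>\<^sub>F N in sequentially. norm (cesaro \<rho> N) \<le> c * inverse (real (Suc N))"
  proof (intro always_eventually allI)
    fix N
    have "(\<Sum>k<Suc N. \<rho> ^ k) = (\<rho> ^ Suc N - 1) / (\<rho> - 1)"
      by (rule geometric_sum[OF assms(2)])
    moreover have "norm (\<rho> ^ Suc N - 1) \<le> norm (\<rho> ^ Suc N) + 1"
      by (rule norm_triangle_le_diff) simp
    moreover have "norm (\<rho> ^ Suc N) \<le> 1"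
      using assms by (simp only: norm_power power_le_one norm_ge_zero)
    ultimately have "norm (\<Sum>k<Suc N. \<rho> ^ k) \<le> c"
      unfolding c_def by (simp only: norm_divide) (intro divide_right_mono; simp)
    thus "norm (cesaro \<rho> N) \<le> c * inverse (real (Suc N))"
      by (simp only: cesaro_def divide_inverse norm_mult norm_inverse norm_of_nat) (intro mult_right_mono; simp)
  qed
  show "(\<lambda>N. c * inverse (real (Suc N))) \<longlonglongrightarrow> 0"
    using tendsto_mult_right_zero[OF LIMSEQ_inverse_real_of_nat] by simp
qed

section \<open>The translation operator is diagonal\<close>

locale dirichlet_translation = dirichlet_space +
  fixes b :: complex
  assumes self_map: "(\<lambda>z. z + b) ` H_domain lam beta \<subseteq> H_domain lam beta"
begin

abbreviation "T \<equiv> comp_op lam beta (\<lambda>z. z + b)"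

definition eigenvalue :: "nat \<Rightarrow> complex" where
  "eigenvalue n = exp (- (complex_of_real (lam n) * b))"

text \<open>
  If \<open>Re b < 0\<close>, the point \<open>abscissa - Re b\<close> of the half-plane would be moved onto the boundary line.
\<close>

lemma Re_b_nonneg: "Re b \<ge> 0"
proof (rule ccontr)
  assume "\<not> Re b \<ge> 0"
  hence "of_real (abscissa - Re b) \<in> H_domain lam beta"
    by (simp add: mem_dom_iff)
  hence "of_real (abscissa - Re b) + b \<in> H_domain lam beta"
    using self_map by blast
  thus False by (simp add: mem_dom_iff)
qed

lemma eigenvalue_nonzero: "eigenvalue n \<noteq> 0"
  by (simp add: eigenvalue_def)

lemma norm_eigenvalue_antimono:
  assumes "1 \<le> n" "n \<le> m"
  shows "cmod (eigenvalue m) \<le> cmod (eigenvalue n)"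
proof -
  have "lam n \<le> lam m" using assms lam_less[of n m] by (cases "n = m") auto
  thus ?thesis using Re_b_nonneg by (simp add: eigenvalue_def mult_right_mono)
qed

lemma norm_eigenvalue_le_1: "n \<ge> 1 \<Longrightarrow> cmod (eigenvalue n) \<le> 1"
  using lam_nonneg Re_b_nonneg by (simp add: eigenvalue_def)

lemma expands_T:
  assumes f: "expands f a"
  shows "expands (T f) (\<lambda>n. eigenvalue n * a n)"
proof -
  have a: "square_summable a" using f by (rule expands_square_summable)
  have "cmod (eigenvalue n * a n) \<le> cmod (a n)" for n
  proof (cases "n = 0")
    case True
    thus ?thesis using a by (simp add: square_summable_def)
  next
    case False
    thus ?thesis
      using norm_eigenvalue_le_1[of n] by (simp add: norm_mult mult_left_le_one_le)
  qed
  hence "square_summable (\<lambda>n. eigenvalue n * a n)"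
    by (rule square_summable_dominated[OF a])
  moreover have "(\<lambda>n. eigenvalue n * a n * exp (- (complex_of_real (lam n) * z))) sums T f z"
    if "z \<in> \<Omega>" for z
  proof -
    have "z + b \<in> \<Omega>" using self_map that by blast
    hence "(\<lambda>n. a n * exp (- (complex_of_real (lam n) * (z + b)))) sums f (z + b)"
      using f by (simp add: expands_iff)
    moreover have "a n * exp (- (complex_of_real (lam n) * (z + b)))
        = eigenvalue n * a n * exp (- (complex_of_real (lam n) * z))" for n
    proof -
      have "exp (- (complex_of_real (lam n) * (z + b)))
          = eigenvalue n * exp (- (complex_of_real (lam n) * z))"
        unfolding eigenvalue_def exp_add[symmetric] by (simp add: algebra_simps)
      thus ?thesis by (simp only: mult.assoc mult.left_commute)
    qed
    ultimately show ?thesis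
      using that by (simp add: comp_op_def)
  qed
  ultimately show ?thesis by (simp add: expands_iff)
qed

lemma T_in_H: "f \<in> H \<Longrightarrow> T f \<in> H"
  using expands_T[OF expands_coeff] by (rule H_I) (auto simp: comp_op_def)

lemma coeff_T: "f \<in> H \<Longrightarrow> dcoeff (T f) n = eigenvalue n * dcoeff f n"
  by (simp add: coeff_eqI[OF expands_T[OF expands_coeff]])

lemma T_pow_in_H: "f \<in> H \<Longrightarrow> (T ^^ k) f \<in> H"
  by (induction k) (auto intro: T_in_H)

lemma coeff_T_pow: "f \<in> H \<Longrightarrow> dcoeff ((T ^^ k) f) n = eigenvalue n ^ k * dcoeff f n"
  by (induction k) (auto simp: coeff_T T_pow_in_H)

section \<open>Cyclicity\<close>

abbreviation "orbit_span x \<equiv> module.span fun_scale (Orb T x)"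

lemma orbit_span_subset_H: "x \<in> H \<Longrightarrow> orbit_span x \<subseteq> H"
  by (intro module.span_minimal[OF module_fun_scale] subspace_H) (auto simp: Orb_def T_pow_in_H)

lemma subspace_orbit_span: "module.subspace fun_scale (orbit_span x)"
  by (rule module.subspace_span[OF module_fun_scale])

text \<open>
  Averaging the orbit with the factors \<open>eigenvalue m ^ (- k)\<close> isolates the \<open>m\<close>-th coefficient among
  the indices \<open>n \<ge> m\<close>. The coefficients with \<open>n < m\<close> cannot be controlled, as the ratio of the
  eigenvalues may exceed 1 in modulus, but they make up a combination of monomials covered by the
  induction hypothesis.
\<close>

lemma monomial_in_closure_orbit_span:
  assumes x: "x \<in> H" "\<And>n. n \<ge> 1 \<Longrightarrow> dcoeff x n \<noteq> 0"
    and inj: "inj_on eigenvalue {1..}"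
    and m: "m \<ge> 1"
  shows "monomial m \<in> H_closure (orbit_span x)"
  using m
proof (induction m rule: less_induct)
  case (less m)
  let ?S = "orbit_span x"
  note S = orbit_span_subset_H[OF x(1)]
  note cl = subspace_closure[OF S subspace_orbit_span]
  define c where "c n N = dcoeff x n * cesaro (eigenvalue n / eigenvalue m) N" for n N
  \<comment> \<open>\<open>g N\<close> is the weighted mean of the orbit, \<open>l N\<close> its part below \<open>m\<close>, and \<open>r N\<close> is minus its part
    above \<open>m\<close>, which has to vanish in the limit.\<close>
  define g where "g N = (\<Sum>k<Suc N. fun_scale (1 / (of_nat (Suc N) * eigenvalue m ^ k)) ((T ^^ k) x))" for N
  define l where "l N = (\<Sum>n\<in>{1..<m}. fun_scale (c n N) (monomial n))" for N
  define r where "r N = fun_scale (dcoeff x m) (monomial m) - (g N - l N)" for N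
  have "g N \<in> ?S" for N
    unfolding g_def
    by (intro module.subspace_sum[OF module_fun_scale subspace_orbit_span]
          module.subspace_scale[OF module_fun_scale subspace_orbit_span]
          module.span_base[OF module_fun_scale]) (auto simp: Orb_def)
  hence g_cl: "g N \<in> H_closure ?S" for N using subset_closure[OF S] by blast
  have l_cl: "l N \<in> H_closure ?S" for N
    unfolding l_def
    by (intro module.subspace_sum[OF module_fun_scale cl] module.subspace_scale[OF module_fun_scale cl] less.IH) auto
  have H: "g N \<in> H" "l N \<in> H" for N using g_cl l_cl by (auto simp: H_closure_def)
  have mH: "fun_scale (dcoeff x m) (monomial m) \<in> H" using less.prems by (intro H_scale monomial_in_H)
  have coeff_g: "dcoeff (g N) n = c n N" for N n
  proof -
    have "dcoeff (g N) n = (\<Sum>k<Suc N. 1 / (of_nat (Suc N) * eigenvalue m ^ k) * (eigenvalue n ^ k * dcoeff x n))"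
      unfolding g_def
      by (subst coeff_sum) (auto simp only: H_scale T_pow_in_H[OF x(1)] coeff_scale coeff_T_pow[OF x(1)])
    also have "\<dots> = c n N"
      unfolding c_def cesaro_def sum_divide_distrib sum_distrib_left
      by (intro sum.cong refl) (simp add: power_divide field_simps)
    finally show ?thesis .
  qed
  have coeff_l: "dcoeff (l N) n = (if n \<in> {1..<m} then c n N else 0)" for N n
  proof -
    have "dcoeff (l N) n = (\<Sum>i\<in>{1..<m}. if n = i then c i N else 0)"
      unfolding l_def
      by (subst coeff_sum) (auto simp: H_scale monomial_in_H coeff_scale coeff_monomial mult_delta_right)
    thus ?thesis by simp
  qed
  have coeff_r: "dcoeff (r N) n = (if n \<le> m then 0 else - c n N)" for N n
  proof -
    have "dcoeff (r N) n = (if n = m then dcoeff x m else 0) - (c n N - dcoeff (l N) n)"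
      unfolding r_def using less.prems
      by (simp add: coeff_diff H H_diff mH coeff_g coeff_scale coeff_monomial monomial_in_H del: fun_diff_def)
    moreover have "c m N = dcoeff x m" by (simp add: c_def eigenvalue_nonzero cesaro_1)
    moreover have "c 0 N = 0" by (simp add: c_def coeff_0[OF x(1)])
    ultimately show ?thesis using less.prems by (cases "n = 0") (auto simp: coeff_l)
  qed
  have ratio: "cmod (eigenvalue n / eigenvalue m) \<le> 1" "eigenvalue n / eigenvalue m \<noteq> 1" if "n > m" for n
    using norm_eigenvalue_antimono[OF less.prems, of n] that less.prems inj_onD[OF inj, of n m]
    by (auto simp: norm_divide eigenvalue_nonzero divide_le_eq_1)
  have "(\<lambda>N. normsq (r N)) \<longlonglongrightarrow> 0"
  proof (rule normsq_tendsto_0[OF x(1)])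
    show "cmod (dcoeff (r N) n) \<le> cmod (dcoeff x n)" for N n
      using norm_cesaro_le[OF ratio(1)] by (auto simp: coeff_r c_def norm_mult mult_left_le)
    show "(\<lambda>N. dcoeff (r N) n) \<longlonglongrightarrow> 0" for n
      using tendsto_mult_right_zero[OF cesaro_tendsto_0[OF ratio], of n "- dcoeff x n"]
      by (cases "n \<le> m") (auto simp: coeff_r c_def)
  qed
  hence "\<exists>N. normsq (r N) < \<epsilon>" if "\<epsilon> > 0" for \<epsilon>
    using that eventually_happens[OF order_tendstoD(2)] by fastforce
  moreover have "g N - l N \<in> H_closure ?S" for N
    by (intro module.subspace_diff[OF module_fun_scale cl] g_cl l_cl)
  ultimately have "fun_scale (dcoeff x m) (monomial m) \<in> H_closure ?S"
    unfolding r_def by (intro closure_closed[OF S mH]) blast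
  hence "fun_scale (1 / dcoeff x m) (fun_scale (dcoeff x m) (monomial m)) \<in> H_closure ?S"
    by (rule module.subspace_scale[OF module_fun_scale cl])
  moreover have "fun_scale (1 / dcoeff x m) (fun_scale (dcoeff x m) (monomial m)) = monomial m"
    using x(2)[OF less.prems] by (simp add: fun_scale_def)
  ultimately show ?case by simp
qed

lemma ex_nonzero_coeffs: "\<exists>x\<in>H. \<forall>n\<ge>1. dcoeff x n \<noteq> 0"
proof -
  define a where "a n = (if n = 0 then 0 else complex_of_real (1 / (real n * beta n)))" for n
  have "(cmod (a n))\<^sup>2 * (beta n)\<^sup>2 = inverse (real n ^ 2)" for n
    using beta_pos[of n]
    by (cases "n = 0") (auto simp: a_def power_divide power_mult_distrib field_simps norm_divide norm_mult)
  hence "square_summable a"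
    using inverse_power_summable[of 2, where 'a = real] by (simp add: square_summable_def a_def)
  then obtain x where "x \<in> H" "dcoeff x = a" using ex_coeff by blast
  moreover have "a n \<noteq> 0" if "n \<ge> 1" for n using beta_pos[OF that] that by (simp add: a_def)
  ultimately show ?thesis by auto
qed

text \<open>
  For the forward direction, a coincidence of two eigenvalues makes any relation
  \<open>\<alpha> * x p + \<gamma> * x q = 0\<close> between the two coefficients of \<open>x\<close> pass to the whole span, which forces
  \<open>\<alpha> = 0\<close>. Such a relation always exists: taking \<open>\<alpha> = x m\<close> and \<open>\<gamma> = - x n\<close> shows \<open>x m = 0\<close>, and then
  \<open>\<alpha> = 1\<close>, \<open>\<gamma> = 0\<close> is a relation as well.
\<close>

theorem cyclic_iff: "H_cyclic lam beta T \<longleftrightarrow> inj_on eigenvalue {1..}"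
proof
  assume inj: "inj_on eigenvalue {1..}"
  obtain x where x: "x \<in> H" "\<And>n. n \<ge> 1 \<Longrightarrow> dcoeff x n \<noteq> 0" using ex_nonzero_coeffs by blast
  note S = orbit_span_subset_H[OF x(1)]
  have "H_dense lam beta (orbit_span x)"
    unfolding H_dense_iff_closure[OF S]
    by (intro H_subset_closure_if_monomials[OF S subspace_orbit_span] monomial_in_closure_orbit_span x inj)
  thus "H_cyclic lam beta T" using x(1) by (auto simp: H_cyclic_def)
next
  assume "H_cyclic lam beta T"
  then obtain x where x: "x \<in> H" and D: "H_dense lam beta (orbit_span x)"
    by (auto simp: H_cyclic_def)
  show "inj_on eigenvalue {1..}"
  proof (rule inj_onI, rule ccontr)
    fix n m :: nat assume nm: "n \<in> {1..}" "m \<in> {1..}" "eigenvalue n = eigenvalue m" "n \<noteq> m"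
    have functional: "\<alpha> = 0" if \<alpha>: "\<alpha> * dcoeff x p + \<gamma> * dcoeff x q = 0" and pq: "{p, q} = {n, m}" for \<alpha> \<gamma> p q
    proof (rule ccontr)
      assume "\<alpha> \<noteq> 0"
      let ?V = "{g \<in> H. \<alpha> * dcoeff g p + \<gamma> * dcoeff g q = 0}"
      have eig: "eigenvalue p = eigenvalue q" "p \<ge> 1" "q \<ge> 1" "p \<noteq> q"
        using pq nm by (auto simp: doubleton_eq_iff)
      have "Orb T x \<subseteq> ?V"
      proof
        fix y assume "y \<in> Orb T x"
        then obtain k where y: "y = (T ^^ k) x" by (auto simp: Orb_def)
        have "\<alpha> * dcoeff y p + \<gamma> * dcoeff y q = eigenvalue q ^ k * (\<alpha> * dcoeff x p + \<gamma> * dcoeff x q)"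
          by (simp add: y coeff_T_pow[OF x] eig algebra_simps)
        thus "y \<in> ?V" using \<alpha> y T_pow_in_H[OF x] by simp
      qed
      moreover have "module.subspace fun_scale ?V"
        unfolding module.subspace_def[OF module_fun_scale]
      proof (intro conjI ballI allI)
        show "0 \<in> ?V" using H_zero by (simp add: coeff_zero del: zero_fun_apply)
        show "f + g \<in> ?V" if "f \<in> ?V" "g \<in> ?V" for f g
        proof -
          have "\<alpha> * dcoeff (f + g) p + \<gamma> * dcoeff (f + g) q
             = (\<alpha> * dcoeff f p + \<gamma> * dcoeff f q) + (\<alpha> * dcoeff g p + \<gamma> * dcoeff g q)"
            using that by (simp add: coeff_add algebra_simps del: plus_fun_apply)
          thus ?thesis using that by (simp add: H_add del: plus_fun_apply)
        qed
        show "fun_scale k f \<in> ?V" if "f \<in> ?V" for k f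
        proof -
          have f: "f \<in> H" using that by simp
          have "\<alpha> * dcoeff (fun_scale k f) p + \<gamma> * dcoeff (fun_scale k f) q
             = k * (\<alpha> * dcoeff f p + \<gamma> * dcoeff f q)"
            using f by (simp add: coeff_scale algebra_simps)
          thus ?thesis using that by (simp add: H_scale)
        qed
      qed
      ultimately have "orbit_span x \<subseteq> ?V" by (rule module.span_minimal[OF module_fun_scale])
      moreover obtain g where "g \<in> orbit_span x"
        and g: "cmod \<alpha> * cmod (1 - dcoeff g p) + cmod \<gamma> * cmod (dcoeff g q) < cmod \<alpha>"
        using dense_near_monomial[OF D eig(2-4), of "cmod \<alpha>" "cmod \<gamma>"] \<open>\<alpha> \<noteq> 0\<close> by auto
      ultimately have "\<alpha> * dcoeff g p + \<gamma> * dcoeff g q = 0" by blast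
      hence "\<alpha> = \<alpha> * (1 - dcoeff g p) - \<gamma> * dcoeff g q" by (simp add: algebra_simps)
      hence "cmod \<alpha> \<le> cmod (\<alpha> * (1 - dcoeff g p)) + cmod (\<gamma> * dcoeff g q)"
        by (metis norm_triangle_ineq4)
      thus False using g by (simp add: norm_mult)
    qed
    have "dcoeff x m = 0"
      by (rule functional[of "dcoeff x m" n "- dcoeff x n" m]) (auto simp: algebra_simps)
    hence "(1::complex) = 0"
      by (intro functional[of 1 m 0 n]) auto
    thus False by simp
  qed
qed

section \<open>Failure of supercyclicity\<close>

text \<open>
  When \<open>x\<close> has a nonzero first coefficient, the inequality \<open>\<bar>x 1\<bar> * \<bar>g 2\<bar> \<le> \<bar>x 2\<bar> * \<bar>g 1\<bar>\<close> holds on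
  the projective orbit and excludes a neighbourhood of the second monomial. Otherwise the first
  coefficient vanishes on the whole projective orbit, which excludes a neighbourhood of the first
  monomial.
\<close>

theorem not_supercyclic: "\<not> H_supercyclic lam beta T"
proof
  assume "H_supercyclic lam beta T"
  then obtain x where x: "x \<in> H"
    and D: "H_dense lam beta {fun_scale \<mu> y | \<mu> y. y \<in> Orb T x}" (is "H_dense _ _ ?S")
    by (auto simp: H_supercyclic_def)
  have coeff_S: "\<exists>\<mu> k. \<forall>n. dcoeff g n = \<mu> * (eigenvalue n ^ k * dcoeff x n)" if g: "g \<in> ?S" for g
  proof -
    obtain \<mu> k where "g = fun_scale \<mu> ((T ^^ k) x)" using g by (auto simp: Orb_def)
    thus ?thesis by (auto simp: coeff_scale T_pow_in_H x coeff_T_pow)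
  qed
  show False
  proof (cases "dcoeff x 1 = 0")
    case True
    obtain g where "g \<in> ?S" "1 * cmod (1 - dcoeff g 1) + 0 * cmod (dcoeff g 2) < 1"
      using dense_near_monomial[OF D, of 1 2 1 0] by auto
    moreover from this have "dcoeff g 1 = 0" using coeff_S True by fastforce
    ultimately show False by simp
  next
    case False
    obtain g where g: "g \<in> ?S"
      "cmod (dcoeff x 1) * cmod (1 - dcoeff g 2) + cmod (dcoeff x 2) * cmod (dcoeff g 1) < cmod (dcoeff x 1)"
      using dense_near_monomial[OF D, of 2 1 "cmod (dcoeff x 1)" "cmod (dcoeff x 2)"] False by auto
    then obtain \<mu> k where k: "\<And>n. dcoeff g n = \<mu> * (eigenvalue n ^ k * dcoeff x n)" using coeff_S by blast
    have "cmod (eigenvalue 2) ^ k \<le> cmod (eigenvalue 1) ^ k"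
      by (intro power_mono norm_eigenvalue_antimono) auto
    from mult_right_mono[OF this, of "cmod \<mu> * cmod (dcoeff x 1) * cmod (dcoeff x 2)"]
    have "cmod (dcoeff x 1) * cmod (dcoeff g 2) \<le> cmod (dcoeff x 2) * cmod (dcoeff g 1)"
      by (simp add: k norm_mult norm_power mult_ac)
    moreover have "cmod (dcoeff x 1) * 1 \<le> cmod (dcoeff x 1) * (cmod (1 - dcoeff g 2) + cmod (dcoeff g 2))"
      using norm_triangle_ineq[of "1 - dcoeff g 2" "dcoeff g 2"] by (intro mult_left_mono) auto
    ultimately show False using g(2) by (simp add: ring_distribs)
  qed
qed

section \<open>The arithmetic form of the criterion\<close>

lemma inj_eigenvalue_iff:
  "inj_on eigenvalue {1..} \<longleftrightarrow>
     (\<forall>n\<ge>1. \<forall>m\<ge>1. n \<noteq> m \<longrightarrow>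
        complex_of_real (lam n - lam m) * b \<notin> {2 * complex_of_real pi * \<i> * of_int k | k :: int. True})"
proof -
  have "eigenvalue m = eigenvalue n \<longleftrightarrow>
      complex_of_real (lam n - lam m) * b \<in> {2 * complex_of_real pi * \<i> * of_int k | k :: int. True}" for n m
  proof -
    have "- (complex_of_real (lam m) * b) = - (complex_of_real (lam n) * b) + of_int (2 * k) * pi * \<i>
        \<longleftrightarrow> complex_of_real (lam n - lam m) * b = 2 * complex_of_real pi * \<i> * of_int k" for k
      by (auto simp: algebra_simps)
    thus ?thesis unfolding eigenvalue_def exp_eq by auto
  qed
  thus ?thesis by (fastforce simp: inj_on_def)
qed

end

theorem proposition5p5:
  fixes lam beta :: "nat \<Rightarrow> real" and b :: complex
  assumes lam_nonneg: "\<And>n. n \<ge> 1 \<Longrightarrow> lam n \<ge> 0"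
    and lam_strict_mono: "strict_mono_on {1..} lam"
    and lam_at_top: "filterlim lam at_top sequentially"
    and L_finite: "dirichlet_L lam < \<infinity>"
    and beta_pos: "\<And>n. n \<ge> 1 \<Longrightarrow> beta n > 0"
    and beta_star_finite: "beta_star lam beta \<noteq> \<infinity>" "beta_star lam beta \<noteq> -\<infinity>"
    and b_nonzero: "b \<noteq> 0"
    and bounded: "bounded_comp_op lam beta (\<lambda>z. z + b)"
  shows "(H_cyclic lam beta (comp_op lam beta (\<lambda>z. z + b)) \<longleftrightarrow>
           (\<forall>n\<ge>1. \<forall>m\<ge>1. n \<noteq> m \<longrightarrow>
              complex_of_real (lam n - lam m) * b \<notin>
                {2 * complex_of_real pi * \<i> * of_int k | k :: int. True}))
         \<and> \<not> H_supercyclic lam beta (comp_op lam beta (\<lambda>z. z + b))"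
proof -
  interpret dirichlet_translation lam beta b
    using assms by unfold_locales (auto simp: bounded_comp_op_def)
  show ?thesis
    using cyclic_iff not_supercyclic unfolding inj_eigenvalue_iff by blast
qed

end
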